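(* Let $\Omega:[0,n]\times[0,m]\to G_1^4$, $(u,t)\mapsto\Omega(u,t)$, be a smooth one-parameter family of admissible curves in the pseudo-Galilean 4-space with Frenet-Serret frame $\{T,N,B_1,B_2\}$ and curvatures $\kappa,\tau,\sigma\neq 0$, and let its flow be written as $$\frac{\partial\Omega}{\partial t}=f_1T+f_2N+f_3B_1+f_4B_2$$ for some differentiable functions $f_1,f_2,f_3,f_4$. Then the flow of $\Omega(u,t)$ in $G_1^4$ is inextensible, i.e. $\frac{\partial}{\partial t}\left\|\frac{\partial\Omega}{\partial u}\right\|=0$, if and only if $f_1$ is constant.
   Context: The pseudo-Galilean 4-space $G_1^4$ is $\mathbb{R}^4$ with the scalar product of vectors $U=(u_1,u_2,u_3,u_4)$, $V=(v_1,v_2,v_3,v_4)$ given by $\langle U,V\rangle=u_1v_1$ if $u_1\ne0$ or $v_1\neq0$, and $\langle U,V\rangle=-u_2v_2+u_3v_3+u_4v_4$ if $u_1=v_1=0$. The norm is $\|U\|=\sqrt{|\langle U,U\rangle|}$. A vector is isotropic if its first component is $0$. A curve $\alpha=(x,y,z,w)$ is admissible if $x'\neq0$ everywhere. For each fixed $t$, the speed is $v=\left\|\frac{\partial\Omega}{\partial u}\right\|$, arclength is $s(u)=\int_0^u v\,du$, so $\frac{\partial}{\partial s}=\frac1v\frac{\partial}{\partial u}$, and $T=\frac{\partial\Omega}{\partial s}$ is the unit tangent. The vectors $N,B_1,B_2$ are isotropic, $\{T,N,B_1,B_2\}$ are mutually orthogonal, and $\langle T,T\rangle=1$, $\langle N,N\rangle=\varepsilon_1$,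 $\langle B_1,B_1\rangle=\varepsilon_2$, $\langle B_2,B_2\rangle=\varepsilon_3$, where $\varepsilon_i\in\{\pm1\}$ and $\varepsilon_3=-1$ if $\varepsilon_1=\varepsilon_2=1$, $\varepsilon_3=1$ otherwise. The frame satisfies the Frenet-Serret equations $$\frac{\partial T}{\partial s}=\varepsilon_1\kappa N,\quad \frac{\partial N}{\partial s}=\varepsilon_2\tau B_1,\quad \frac{\partial B_1}{\partial s}=-\varepsilon_1\tau N+\varepsilon_3\sigma B_2,\quad \frac{\partial B_2}{\partial s}=-\varepsilon_2\sigma B_1,$$ where $\kappa,\tau,\sigma$ are the first, second and third curvatures.
   Formalization: "f_1 is constant" is taken as: for each fixed t, f_1 is constant in u. Constancy in (u,t) jointly would make the "only if" part false, e.g. for the translating family Ω(u,t)=γ(u)+(t²/2,0,0,0), which is inextensible with f_1=t. *)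

theory Defs
  imports "HOL-Analysis.Analysis"
begin

definition pg_inner :: "real^4 \<Rightarrow> real^4 \<Rightarrow> real" where
  "pg_inner U V =
     (if U$1 \<noteq> 0 \<or> V$1 \<noteq> 0 then U$1 * V$1
      else - (U$2 * V$2) + U$3 * V$3 + U$4 * V$4)"

definition pg_norm :: "real^4 \<Rightarrow> real" where
  "pg_norm U = sqrt \<bar>pg_inner U U\<bar>"

definition isotropic :: "real^4 \<Rightarrow> bool" where
  "isotropic U \<longleftrightarrow> U$1 = 0"

text \<open>
  Continuous differentiability up to order \<open>k\<close> on a subset of the plane, where \<open>fu\<close> and \<open>ft\<close> are
  the two partial derivatives. On a closed rectangle with nonempty interior the derivatives at
  boundary points are relative to the rectangle, hence one-sided there and uniquely determined.
\<close>

primrec Ck_on :: "nat \<Rightarrow> (real \<times> real) set \<Rightarrow> (real \<times> real \<Rightarrow> 'a::real_normed_vector) \<Rightarrow> bool" where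
  "Ck_on 0 S f \<longleftrightarrow> continuous_on S f"
| "Ck_on (Suc k) S f \<longleftrightarrow>
     (\<exists>fu ft. (\<forall>p\<in>S. (f has_derivative (\<lambda>h. fst h *\<^sub>R fu p + snd h *\<^sub>R ft p)) (at p within S)) \<and>
        Ck_on k S fu \<and> Ck_on k S ft)"

definition smooth_on :: "(real \<times> real) set \<Rightarrow> (real \<times> real \<Rightarrow> 'a::real_normed_vector) \<Rightarrow> bool" where
  "smooth_on S f \<longleftrightarrow> (\<forall>k. Ck_on k S f)"

text \<open>
  Partial derivatives of a map on \<open>[0,n] \<times> [0,m]\<close>, one-sided at the endpoints of the intervals.
\<close>

definition d_u :: "real \<Rightarrow> (real \<Rightarrow> real \<Rightarrow> 'a::real_normed_vector) \<Rightarrow> real \<Rightarrow> real \<Rightarrow> 'a" where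
  "d_u n F u t = vector_derivative (\<lambda>u'. F u' t) (at u within {0..n})"

definition d_t :: "real \<Rightarrow> (real \<Rightarrow> real \<Rightarrow> 'a::real_normed_vector) \<Rightarrow> real \<Rightarrow> real \<Rightarrow> 'a" where
  "d_t m F u t = vector_derivative (\<lambda>t'. F u t') (at t within {0..m})"

definition admissible_family :: "real \<Rightarrow> real \<Rightarrow> (real \<Rightarrow> real \<Rightarrow> real^4) \<Rightarrow> bool" where
  "admissible_family n m \<Omega> \<longleftrightarrow> (\<forall>u\<in>{0..n}. \<forall>t\<in>{0..m}. d_u n \<Omega> u t $ 1 \<noteq> 0)"

definition speed :: "real \<Rightarrow> (real \<Rightarrow> real \<Rightarrow> real^4) \<Rightarrow> real \<Rightarrow> real \<Rightarrow> real" where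
  "speed n \<Omega> u t = pg_norm (d_u n \<Omega> u t)"

text \<open>
  The derivative with respect to the arclength \<open>s\<close> of the curve \<open>\<Omega>(\<cdot>, t)\<close>. Since
  \<open>ds/du\<close> is the speed, this is the \<open>u\<close>-derivative divided by the speed.
\<close>

definition d_s :: "real \<Rightarrow> (real \<Rightarrow> real \<Rightarrow> real^4) \<Rightarrow> (real \<Rightarrow> real \<Rightarrow> real^4) \<Rightarrow> real \<Rightarrow> real \<Rightarrow> real^4" where
  "d_s n \<Omega> F u t = (1 / speed n \<Omega> u t) *\<^sub>R d_u n F u t"

text \<open>
  The derivative \<open>vector_derivative\<close> underlying \<open>d_s\<close> is meaningful only for differentiable
  arguments, so differentiability of the frame along each curve is required explicitly.
\<close>

definition frenet_frame ::
  "real \<Rightarrow> real \<Rightarrow> (real \<Rightarrow> real \<Rightarrow> real^4) \<Rightarrow>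
   (real \<Rightarrow> real \<Rightarrow> real^4) \<Rightarrow> (real \<Rightarrow> real \<Rightarrow> real^4) \<Rightarrow> (real \<Rightarrow> real \<Rightarrow> real^4) \<Rightarrow> (real \<Rightarrow> real \<Rightarrow> real^4) \<Rightarrow>
   (real \<Rightarrow> real \<Rightarrow> real) \<Rightarrow> (real \<Rightarrow> real \<Rightarrow> real) \<Rightarrow> (real \<Rightarrow> real \<Rightarrow> real) \<Rightarrow>
   real \<Rightarrow> real \<Rightarrow> real \<Rightarrow> bool" where
  "frenet_frame n m \<Omega> T N B1 B2 \<kappa> \<tau> \<sigma> \<epsilon>1 \<epsilon>2 \<epsilon>3 \<longleftrightarrow>
     \<epsilon>1 \<in> {-1, 1} \<and> \<epsilon>2 \<in> {-1, 1} \<and>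
     \<epsilon>3 = (if \<epsilon>1 = 1 \<and> \<epsilon>2 = 1 then -1 else 1) \<and>
     (\<forall>u\<in>{0..n}. \<forall>t\<in>{0..m}.
        T u t = d_s n \<Omega> \<Omega> u t \<and>
        isotropic (N u t) \<and> isotropic (B1 u t) \<and> isotropic (B2 u t) \<and>
        pg_inner (T u t) (N u t) = 0 \<and> pg_inner (T u t) (B1 u t) = 0 \<and>
        pg_inner (T u t) (B2 u t) = 0 \<and> pg_inner (N u t) (B1 u t) = 0 \<and>
        pg_inner (N u t) (B2 u t) = 0 \<and> pg_inner (B1 u t) (B2 u t) = 0 \<and>
        pg_inner (T u t) (T u t) = 1 \<and> pg_inner (N u t) (N u t) = \<epsilon>1 \<and>
        pg_inner (B1 u t) (B1 u t) = \<epsilon>2 \<and> pg_inner (B2 u t) (B2 u t) = \<epsilon>3 \<and>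
        (\<forall>F\<in>{T, N, B1, B2}. (\<lambda>u'. F u' t) differentiable (at u within {0..n})) \<and>
        d_s n \<Omega> T u t = (\<epsilon>1 * \<kappa> u t) *\<^sub>R N u t \<and>
        d_s n \<Omega> N u t = (\<epsilon>2 * \<tau> u t) *\<^sub>R B1 u t \<and>
        d_s n \<Omega> B1 u t = - (\<epsilon>1 * \<tau> u t) *\<^sub>R N u t + (\<epsilon>3 * \<sigma> u t) *\<^sub>R B2 u t \<and>
        d_s n \<Omega> B2 u t = - (\<epsilon>2 * \<sigma> u t) *\<^sub>R B1 u t)"

definition inextensible_flow :: "real \<Rightarrow> real \<Rightarrow> (real \<Rightarrow> real \<Rightarrow> real^4) \<Rightarrow> bool" where
  "inextensible_flow n m \<Omega> \<longleftrightarrow>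
     (\<forall>u\<in>{0..n}. \<forall>t\<in>{0..m}.
        ((\<lambda>t'. pg_norm (d_u n \<Omega> u t')) has_real_derivative 0) (at t within {0..m}))"

end

theory Submission
  imports Defs
begin

text \<open>
  Only the first coordinate \<open>x\<close> of \<open>\<Omega>\<close> matters: the speed is \<open>\<bar>x\<^sub>u\<bar>\<close>, and since \<open>N, B\<^sub>1, B\<^sub>2\<close> are
  isotropic, \<open>x\<^sub>t = c f\<^sub>1\<close>, where \<open>c = sgn x\<^sub>u\<close> is constant on the connected rectangle. Hence the flow
  is inextensible iff \<open>x\<^sub>u\<close> does not depend on \<open>t\<close>, and \<open>f\<^sub>1\<close> does not depend on \<open>u\<close> iff \<open>x\<^sub>t\<close> does
  not. Both conditions say that \<open>x\<close> is a function of \<open>u\<close> plus a function of \<open>t\<close>, so the symmetry of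
  second derivatives is not even needed.
\<close>

text \<open>Both slices through the point lie in \<open>A \<times> B\<close>, so the total
  derivative restricts to them, and the chain rule with the affine embedding of each slice extracts
  \<open>a\<close> or \<open>b\<close>.\<close>

lemma has_vector_derivative_partials:
  fixes f :: "real \<Rightarrow> real \<Rightarrow> 'a::real_normed_vector"
  assumes "((\<lambda>(u, t). f u t) has_derivative (\<lambda>h. fst h *\<^sub>R a + snd h *\<^sub>R b)) (at (u, t) within A \<times> B)"
    and "u \<in> A" and "t \<in> B"
  shows "((\<lambda>u'. f u' t) has_vector_derivative a) (at u within A)"
    and "((\<lambda>t'. f u t') has_vector_derivative b) (at t within B)"
proof -
  let ?D = "\<lambda>h. fst h *\<^sub>R a + snd h *\<^sub>R b"
  have "(\<lambda>u'. (u', t)) ` A \<subseteq> A \<times> B" "Pair u ` B \<subseteq> A \<times> B"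
    using assms(2,3) by auto
  then have 1: "((\<lambda>(u, t). f u t) has_derivative ?D) (at (u, t) within (\<lambda>u'. (u', t)) ` A)"
    and 2: "((\<lambda>(u, t). f u t) has_derivative ?D) (at (u, t) within Pair u ` B)"
    using has_derivative_subset[OF assms(1)] by blast+
  have 3: "((\<lambda>u'. (u', t)) has_derivative (\<lambda>h. (h, 0))) (at u within A)"
    and 4: "(Pair u has_derivative Pair 0) (at t within B)"
    by (auto intro!: derivative_eq_intros)
  show "((\<lambda>u'. f u' t) has_vector_derivative a) (at u within A)"
    using diff_chain_within[OF 3 1] by (simp add: has_vector_derivative_def o_def)
  show "((\<lambda>t'. f u t') has_vector_derivative b) (at t within B)"
    using diff_chain_within[OF 4 2] by (simp add: has_vector_derivative_def o_def)
qed

text \<open>The hypothesis \<open>eq\<close> forces F to split into a function of u plus a function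
  of t, and differentiating the split form in t removes the first summand. It serves twice below,
  with the two variables exchanging roles.\<close>

lemma partial_independent_swap:
  fixes F :: "real \<Rightarrow> real \<Rightarrow> 'a::real_normed_vector"
  assumes Fu: "\<And>u t. u \<in> A \<Longrightarrow> t \<in> {c..d} \<Longrightarrow>
      ((\<lambda>u'. F u' t) has_vector_derivative Fu u t) (at u within A)"
    and Ft: "\<And>u t. u \<in> A \<Longrightarrow> t \<in> {c..d} \<Longrightarrow>
      ((\<lambda>t'. F u t') has_vector_derivative Ft u t) (at t within {c..d})"
    and eq: "\<And>u t. u \<in> A \<Longrightarrow> t \<in> {c..d} \<Longrightarrow> Fu u t = Fu u c"
    and "convex A" and "c < d" and u: "u \<in> A" "u0 \<in> A" and t: "t \<in> {c..d}"
  shows "Ft u t = Ft u0 t"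
proof -
  have split: "F u t' = F u0 t' + (F u c - F u0 c)" if t': "t' \<in> {c..d}" for t'
  proof -
    \<comment> \<open>By \<open>eq\<close> the u-derivatives of the sections at t' and at c cancel,
      so their difference is constant on the convex set \<open>A\<close>.\<close>
    have "((\<lambda>u'. F u' t' - F u' c) has_vector_derivative 0) (at u' within A)" if "u' \<in> A" for u'
      using has_vector_derivative_diff[OF Fu[OF that t'] Fu[OF that, of c]] eq[OF that t'] \<open>c < d\<close>
      by simp
    then obtain k where "\<And>u'. u' \<in> A \<Longrightarrow> F u' t' - F u' c = k"
      by (rule has_vector_derivative_zero_constant[OF \<open>convex A\<close>]) blast+
    then have "F u t' - F u c = F u0 t' - F u0 c" using u by simp
    then show ?thesis by (simp add: algebra_simps)
  qed
  \<comment> \<open>By \<open>split\<close>, the t-sections at u and u0 differ by a constant. Hence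
    \<open>Ft u0 t\<close> is also a derivative of the section at u, and derivatives within a
    nondegenerate interval are unique.\<close>
  have "((\<lambda>t'. F u0 t' + (F u c - F u0 c)) has_vector_derivative Ft u0 t) (at t within {c..d})"
    using Ft[OF u(2) t] by (rule has_vector_derivative_add_const[THEN iffD2])
  then have "((\<lambda>t'. F u t') has_vector_derivative Ft u0 t) (at t within {c..d})"
    by (rule has_vector_derivative_transform[OF t, rotated]) (rule split)
  with Ft[OF u(1) t] show ?thesis
    by (rule vector_derivative_unique_within_closed_interval[OF \<open>c < d\<close>, unfolded cbox_interval, OF t])
qed

text \<open>The image is an interval of reals missing 0, so it lies on one side of 0. A single sign
  \<open>c\<close> for the whole of \<open>S\<close> turns the absolute value into a linear
  map.\<close>

lemma constant_sign_on_connected: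
  fixes f :: "'a::topological_space \<Rightarrow> real"
  assumes "connected S" and "continuous_on S f" and "\<And>p. p \<in> S \<Longrightarrow> f p \<noteq> 0"
  obtains c where "c \<in> {-1, 1}" and "\<And>p. p \<in> S \<Longrightarrow> \<bar>f p\<bar> = c * f p"
proof -
  have "connected (f ` S)" "0 \<notin> f ` S"
    using assms connected_continuous_image by auto
  then have "(\<forall>p\<in>S. f p > 0) \<or> (\<forall>p\<in>S. f p < 0)"
    by (smt (verit, best) connected_iff_interval image_eqI)
  then show ?thesis
    using that[of 1] that[of "-1"] by fastforce
qed

lemma pg_norm_nonisotropic: "U $ 1 \<noteq> 0 \<Longrightarrow> pg_norm U = \<bar>U $ 1\<bar>"
  by (simp add: pg_norm_def pg_inner_def)

theorem theorem1:
  fixes n m :: real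
    and \<Omega> T N B1 B2 :: "real \<Rightarrow> real \<Rightarrow> real^4"
    and \<kappa> \<tau> \<sigma> f1 f2 f3 f4 :: "real \<Rightarrow> real \<Rightarrow> real"
    and \<epsilon>1 \<epsilon>2 \<epsilon>3 :: real
  assumes "n > 0" and "m > 0"
    and "smooth_on ({0..n} \<times> {0..m}) (\<lambda>(u, t). \<Omega> u t)"
    and "admissible_family n m \<Omega>"
    and "frenet_frame n m \<Omega> T N B1 B2 \<kappa> \<tau> \<sigma> \<epsilon>1 \<epsilon>2 \<epsilon>3"
    and "\<And>u t. u \<in> {0..n} \<Longrightarrow> t \<in> {0..m} \<Longrightarrow> \<kappa> u t \<noteq> 0 \<and> \<tau> u t \<noteq> 0 \<and> \<sigma> u t \<noteq> 0"
    and "\<And>f. f \<in> {f1, f2, f3, f4} \<Longrightarrow> (\<lambda>(u, t). f u t) differentiable_on ({0..n} \<times> {0..m})"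
    and "\<And>u t. u \<in> {0..n} \<Longrightarrow> t \<in> {0..m} \<Longrightarrow>
           d_t m \<Omega> u t = f1 u t *\<^sub>R T u t + f2 u t *\<^sub>R N u t + f3 u t *\<^sub>R B1 u t + f4 u t *\<^sub>R B2 u t"
  shows "inextensible_flow n m \<Omega> \<longleftrightarrow> (\<forall>t\<in>{0..m}. (\<lambda>u. f1 u t) constant_on {0..n})"
proof -
  let ?R = "{0..n} \<times> {0..m}"
  have zero: "0 \<in> {0..n}" "0 \<in> {0..m}" using assms(1,2) by auto
  \<comment> \<open>Order one supplies both partial derivatives together with the continuity of
    \<open>fu\<close>, on which the choice of a global sign rests.\<close>
  have "Ck_on (Suc 0) ?R (\<lambda>(u, t). \<Omega> u t)" using assms(3) unfolding smooth_on_def by blast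
  then obtain fu ft where
    deriv: "\<And>p. p \<in> ?R \<Longrightarrow> ((\<lambda>(u, t). \<Omega> u t) has_derivative
      (\<lambda>h. fst h *\<^sub>R fu p + snd h *\<^sub>R ft p)) (at p within ?R)"
    and cont: "continuous_on ?R fu"
    by auto
  have \<Omega>u: "((\<lambda>u'. \<Omega> u' t) has_vector_derivative fu (u, t)) (at u within {0..n})"
    and \<Omega>t: "((\<lambda>t'. \<Omega> u t') has_vector_derivative ft (u, t)) (at t within {0..m})"
    if "u \<in> {0..n}" "t \<in> {0..m}" for u t
    using has_vector_derivative_partials[OF deriv] that by auto
  have d_u: "d_u n \<Omega> u t = fu (u, t)" and d_t: "d_t m \<Omega> u t = ft (u, t)"
    if "u \<in> {0..n}" "t \<in> {0..m}" for u t
    unfolding d_u_def d_t_def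
    using vector_derivative_within_closed_interval[OF _ _ \<Omega>u[OF that]]
      vector_derivative_within_closed_interval[OF _ _ \<Omega>t[OF that]] that assms(1,2) by auto
  define xu where "xu u t = fu (u, t) $ 1" for u t
  define xt where "xt u t = ft (u, t) $ 1" for u t
  have xu: "((\<lambda>u'. \<Omega> u' t $ 1) has_vector_derivative xu u t) (at u within {0..n})"
    and xt: "((\<lambda>t'. \<Omega> u t' $ 1) has_vector_derivative xt u t) (at t within {0..m})"
    if "u \<in> {0..n}" "t \<in> {0..m}" for u t
    unfolding xu_def xt_def
    using bounded_linear.has_vector_derivative[OF bounded_linear_vec_nth \<Omega>u[OF that]]
      bounded_linear.has_vector_derivative[OF bounded_linear_vec_nth \<Omega>t[OF that]] .
  have xu_nz: "xu u t \<noteq> 0" if "u \<in> {0..n}" "t \<in> {0..m}" for u t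
    using assms(4) d_u[OF that] that unfolding admissible_family_def xu_def by metis
  have "connected ?R" by (intro connected_Times) auto
  moreover have "continuous_on ?R (\<lambda>p. fu p $ 1)"
    using cont by (intro continuous_intros)
  moreover have "fu p $ 1 \<noteq> 0" if "p \<in> ?R" for p
    using xu_nz that unfolding xu_def by auto
  ultimately obtain c where c: "c \<in> {-1, 1}" "\<And>p. p \<in> ?R \<Longrightarrow> \<bar>fu p $ 1\<bar> = c * fu p $ 1"
    by (rule constant_sign_on_connected) auto
  have norm_eq: "pg_norm (d_u n \<Omega> u t) = c * xu u t" if "u \<in> {0..n}" "t \<in> {0..m}" for u t
    using pg_norm_nonisotropic xu_nz[OF that] c(2)[of "(u, t)"] d_u[OF that] that
    by (simp add: xu_def)
  \<comment> \<open>Take first coordinates in the flow equation: the isotropic vectors drop out and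
    only the multiple of T remains.\<close>
  have xt_eq: "xt u t = c * f1 u t" if ut: "u \<in> {0..n}" "t \<in> {0..m}" for u t
  proof -
    have "T u t = d_s n \<Omega> \<Omega> u t" "N u t $ 1 = 0" "B1 u t $ 1 = 0" "B2 u t $ 1 = 0"
      using assms(5) ut by (auto simp: frenet_frame_def isotropic_def)
    \<comment> \<open>This coordinate is \<open>xu u t / (c * xu u t)\<close>, that is
      \<open>1 / c\<close>, which equals \<open>c\<close> for a sign.\<close>
    moreover have "d_s n \<Omega> \<Omega> u t $ 1 = c"
      using c(1) norm_eq[OF ut] d_u[OF ut] xu_nz[OF ut]
      by (auto simp: d_s_def speed_def xu_def)
    ultimately show ?thesis
      using assms(8)[OF ut] d_t[OF ut] by (simp add: xt_def)
  qed

  have "inextensible_flow n m \<Omega> \<longleftrightarrow> (\<forall>u\<in>{0..n}. \<forall>t\<in>{0..m}. xu u t = xu u 0)"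
  proof
    assume L: "inextensible_flow n m \<Omega>"
    show "\<forall>u\<in>{0..n}. \<forall>t\<in>{0..m}. xu u t = xu u 0"
    proof (intro ballI)
      fix u t assume ut: "u \<in> {0..n}" "t \<in> {0..m}"
      obtain k where "\<And>t'. t' \<in> {0..m} \<Longrightarrow> pg_norm (d_u n \<Omega> u t') = k"
        using has_field_derivative_zero_constant[of "{0..m}" "\<lambda>t'. pg_norm (d_u n \<Omega> u t')"]
          L ut(1) unfolding inextensible_flow_def by auto
      then have "c * xu u t = c * xu u 0"
        using norm_eq ut zero by metis
      then show "xu u t = xu u 0" using c(1) by auto
    qed
  next
    assume R: "\<forall>u\<in>{0..n}. \<forall>t\<in>{0..m}. xu u t = xu u 0"
    show "inextensible_flow n m \<Omega>"
      unfolding inextensible_flow_def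
    proof (intro ballI)
      fix u t assume ut: "u \<in> {0..n}" "t \<in> {0..m}"
      have eq: "pg_norm (d_u n \<Omega> u t') = c * xu u 0" if "t' \<in> {0..m}" for t'
        using norm_eq[OF ut(1) that] R ut(1) that by metis
      show "((\<lambda>t'. pg_norm (d_u n \<Omega> u t')) has_real_derivative 0) (at t within {0..m})"
        \<comment> \<open>Agreement with the constant holds on all of \<open>{0..m}\<close>, so any
          positive radius would do; 1 is chosen.\<close>
        using DERIV_const[of "c * xu u 0"] zero_less_one ut(2)
        by (rule has_field_derivative_transform_within) (use eq in auto)
    qed
  qed
  also have "\<dots> \<longleftrightarrow> (\<forall>u\<in>{0..n}. \<forall>t\<in>{0..m}. xt u t = xt 0 t)"
  proof
    assume R: "\<forall>u\<in>{0..n}. \<forall>t\<in>{0..m}. xu u t = xu u 0"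
    show "\<forall>u\<in>{0..n}. \<forall>t\<in>{0..m}. xt u t = xt 0 t"
    proof (intro ballI)
      fix u t assume ut: "u \<in> {0..n}" "t \<in> {0..m}"
      show "xt u t = xt 0 t"
      proof (rule partial_independent_swap[where F = "\<lambda>u t. \<Omega> u t $ 1" and Fu = xu and Ft = xt
            and A = "{0..n}" and c = 0 and d = m])
        show "xu u t = xu u 0" if "u \<in> {0..n}" "t \<in> {0..m}" for u t
          using R that by blast
      qed (use xu xt ut zero assms(2) in simp_all)
    qed
  next
    assume R: "\<forall>u\<in>{0..n}. \<forall>t\<in>{0..m}. xt u t = xt 0 t"
    show "\<forall>u\<in>{0..n}. \<forall>t\<in>{0..m}. xu u t = xu u 0"
    proof (intro ballI)
      fix u t assume ut: "u \<in> {0..n}" "t \<in> {0..m}"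
      show "xu u t = xu u 0"
      \<comment> \<open>For the converse the arguments are flipped: t is now the variable in which F
        is first differentiated, and time 0 is the base point.\<close>
      proof (rule partial_independent_swap[where F = "\<lambda>t u. \<Omega> u t $ 1" and Fu = "\<lambda>t u. xt u t"
            and Ft = "\<lambda>t u. xu u t" and A = "{0..m}" and c = 0 and d = n])
        show "xt u t = xt 0 t" if "t \<in> {0..m}" "u \<in> {0..n}" for t u
          using R that by blast
      qed (use xu xt ut zero assms(1) in simp_all)
    qed
  qed
  also have "\<dots> \<longleftrightarrow> (\<forall>u\<in>{0..n}. \<forall>t\<in>{0..m}. f1 u t = f1 0 t)"
    using xt_eq zero c(1) by auto
  \<comment> \<open>The witness for the constant is the value at u = 0, which may vary with
    t.\<close>
  also have "\<dots> \<longleftrightarrow> (\<forall>t\<in>{0..m}. (\<lambda>u. f1 u t) constant_on {0..n})"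
    using zero(1) unfolding constant_on_def by metis
  finally show ?thesis .
qed

end
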